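(* The permutation statistic $(b-ca)+(b-ca)+(c-ab)+(ba)$ (in which the pattern $b-ca$ is counted twice) is Mahonian; that is, for every $n\ge1$ and every integer $k$, the number of $\pi\in\mathfrak S_n$ with $2\,(b-ca)\,\pi+(c-ab)\,\pi+(ba)\,\pi=k$ equals the number of $\pi\in\mathfrak S_n$ with $\mathrm{inv}\,\pi=k$.
   Context: $\mathfrak S_n$ is the set of permutations $\pi=\pi_1\cdots\pi_n$ of $\{1,\dots,n\}$; $\mathrm{inv}\,\pi=\#\{(i,j):1\le i<j\le n,\ \pi_i>\pi_j\}$. Vincular pattern counts: $(b-ca)\,\pi=\#\{(i,j):i<j<n,\ \pi_{j+1}<\pi_i<\pi_j\}$; $(c-ab)\,\pi=\#\{(i,j):i<j<n,\ \pi_j<\pi_{j+1}<\pi_i\}$; $(ba)\,\pi=\#\{i<n:\pi_i>\pi_{i+1}\}$. A sum of patterns denotes the sum of their counts (with multiplicity). *)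

theory Defs
  imports "HOL-Combinatorics.Permutations"
begin

(* A permutation of {1..n} is a function p with p permutes {1..n}; its one-line
   notation is p 1, ..., p n. *)

definition inv_count :: "nat \<Rightarrow> (nat \<Rightarrow> nat) \<Rightarrow> nat" where
  "inv_count n p = card {(i, j). 1 \<le> i \<and> i < j \<and> j \<le> n \<and> p i > p j}"

definition pat_b_ca :: "nat \<Rightarrow> (nat \<Rightarrow> nat) \<Rightarrow> nat" where
  "pat_b_ca n p = card {(i, j). 1 \<le> i \<and> i < j \<and> j < n \<and> p (j + 1) < p i \<and> p i < p j}"

definition pat_c_ab :: "nat \<Rightarrow> (nat \<Rightarrow> nat) \<Rightarrow> nat" where
  "pat_c_ab n p = card {(i, j). 1 \<le> i \<and> i < j \<and> j < n \<and> p j < p (j + 1) \<and> p (j + 1) < p i}"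

definition pat_ba :: "nat \<Rightarrow> (nat \<Rightarrow> nat) \<Rightarrow> nat" where
  "pat_ba n p = card {i. 1 \<le> i \<and> i < n \<and> p i > p (i + 1)}"

end

theory Submission
  imports Defs "HOL-Computational_Algebra.Polynomial"
begin

text \<open>
  Both statistics behave well when a permutation is built by appending letters. Appending \<open>i\<close> to a permutation of \<open>{1..n}\<close> ending in \<open>j\<close>
  (raising the letters \<open>\<ge> i\<close> by one) increases the inversion number by \<open>n + 1 - i\<close>, and increases
  \<open>2(b-ca) + (c-ab) + (ba)\<close> by \<open>n + 1 - i\<close> if \<open>j < i\<close> and by \<open>2(j - i) + 1\<close> if \<open>j \<ge> i\<close>.
  By induction, for both statistics the permutations ending in \<open>j\<close> have the generating function
  \<open>x^(n-j) [1] [2] \<dots> [n-1]\<close>, where \<open>[m] = 1 + x + \<dots> + x^(m-1)\<close>. For the second statistic the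
  exponents, reduced by \<open>n + 1 - i\<close>, are \<open>n - j\<close> for \<open>j < i\<close> and \<open>j - i\<close> for \<open>j \<ge> i\<close>; these
  run once through \<open>0, \<dots>, n - 1\<close>.
\<close>

section \<open>Appending a letter to a permutation\<close>

text \<open>For \<open>i\<close> in \<open>{1..Suc n}\<close> this is the cycle sending
  \<open>i\<close> to \<open>i + 1\<close>, ..., \<open>n\<close> to \<open>n + 1\<close> and
  \<open>n + 1\<close> to \<open>i\<close>. A permutation \<open>p\<close> of \<open>{1..n}\<close>
  fixes \<open>Suc n\<close>, so \<open>make_room n i \<circ> p\<close> raises the letters from
  \<open>i\<close> on and puts \<open>i\<close> in position \<open>Suc n\<close> at once.\<close>

definition make_room :: "nat \<Rightarrow> nat \<Rightarrow> nat \<Rightarrow> nat" where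
  "make_room n i k = (if k = Suc n then i else if i \<le> k \<and> k \<le> n then Suc k else k)"

lemma make_room_permutes:
  assumes "i \<in> {1..Suc n}"
  shows "make_room n i permutes {1..Suc n}"
proof (rule bij_imp_permutes)
  have inj: "inj_on (make_room n i) {1..Suc n}"
    by (auto simp: inj_on_def make_room_def split: if_splits)
  have "make_room n i ` {1..Suc n} \<subseteq> {1..Suc n}"
    using assms by (auto simp: make_room_def)
  then have "make_room n i ` {1..Suc n} = {1..Suc n}"
    using endo_inj_surj inj by blast
  with inj show "bij_betw (make_room n i) {1..Suc n} {1..Suc n}"
    by (simp add: bij_betw_def)
qed (use assms in \<open>auto simp: make_room_def\<close>)

lemma make_room_less_iff:
  "a \<le> n \<Longrightarrow> b \<le> n \<Longrightarrow> make_room n i a < make_room n i b \<longleftrightarrow> a < b"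
  by (auto simp: make_room_def)

lemma permutes_letter_in_range:
  fixes p :: "nat \<Rightarrow> nat"
  shows "p permutes {1..n} \<Longrightarrow> k \<in> {1..n} \<Longrightarrow> p k \<in> {1..n}"
  by (simp only: permutes_in_image)

lemma append_letter_permutes:
  assumes "i \<in> {1..Suc n}" "p permutes {1..n}"
  shows "make_room n i \<circ> p permutes {1..Suc n}"
  using assms by (intro permutes_compose make_room_permutes permutes_subset[OF assms(2)]) auto

lemma append_letter_last:
  "p permutes {1..n} \<Longrightarrow> (make_room n i \<circ> p) (Suc n) = i"
  by (simp add: permutes_def make_room_def)

text \<open>Injective because \<open>i\<close> is read off as the last letter and
  \<open>make_room n i\<close> can then be cancelled; surjective by counting, as
  \<open>(n + 1) * n! = (n + 1)!\<close>.\<close>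

lemma bij_betw_append_letter:
  "bij_betw (\<lambda>(i, p). make_room n i \<circ> p)
     ({1..Suc n} \<times> {p. p permutes {1..n}}) {p. p permutes {1..Suc n}}"
proof -
  let ?f = "\<lambda>(i, p). make_room n i \<circ> p"
  let ?A = "{1..Suc n} \<times> {p. p permutes {1..n}}"
  have inj: "inj_on ?f ?A"
  proof (rule inj_onI, clarsimp)
    fix i p i' p'
    assume i: "Suc 0 \<le> i" "i \<le> Suc n" "Suc 0 \<le> i'" "i' \<le> Suc n"
      and p: "p permutes {Suc 0..n}" and p': "p' permutes {Suc 0..n}"
      and eq: "make_room n i \<circ> p = make_room n i' \<circ> p'"
    have ii: "i = i'"
      using append_letter_last[of p n i] append_letter_last[of p' n i'] p p' eq by simp
    have "inj (make_room n i)"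
      using make_room_permutes[of i n] i permutes_inj by fastforce
    then have "p = p'"
      using eq ii by (auto simp: fun_eq_iff inj_def)
    with ii show "i = i' \<and> p = p'" ..
  qed
  have "?f ` ?A = {p. p permutes {1..Suc n}}"
  proof (rule card_subset_eq)
    show "?f ` ?A \<subseteq> {p. p permutes {1..Suc n}}"
      using append_letter_permutes by auto
    show "card (?f ` ?A) = card {p. p permutes {1..Suc n}}"
      by (subst card_image[OF inj])
        (simp add: card_cartesian_product card_permutations[of "{Suc 0..n}" n]
          card_permutations[of "{Suc 0..Suc n}" "Suc n"])
  qed (simp add: finite_permutations)
  with inj show ?thesis by (simp add: bij_betw_def)
qed

lemma bij_betw_append_letter_fixed:
  assumes "i \<in> {1..Suc n}"
  shows "bij_betw (\<lambda>p. make_room n i \<circ> p)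
     {p. p permutes {1..n}} {p. p permutes {1..Suc n} \<and> p (Suc n) = i}"
proof -
  have "inj_on (\<lambda>p. make_room n i \<circ> p) {p. p permutes {1..n}}"
    using bij_betw_append_letter[of n] assms unfolding bij_betw_def inj_on_def by auto
  moreover have "(\<lambda>p. make_room n i \<circ> p) ` {p. p permutes {1..n}}
      = {p. p permutes {1..Suc n} \<and> p (Suc n) = i}"
  proof (intro equalityI subsetI)
    fix q assume "q \<in> {p. p permutes {1..Suc n} \<and> p (Suc n) = i}"
    then have q: "q permutes {1..Suc n}" "q (Suc n) = i" by auto
    have "q \<in> (\<lambda>(i, p). make_room n i \<circ> p) ` ({1..Suc n} \<times> {p. p permutes {1..n}})"
      using bij_betw_append_letter[of n] q(1) unfolding bij_betw_def by blast
    then obtain i' p where "p permutes {1..n}" "q = make_room n i' \<circ> p"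
      by force
    with q show "q \<in> (\<lambda>p. make_room n i \<circ> p) ` {p. p permutes {1..n}}"
      using append_letter_last[of p n i'] by auto
  next
    fix q assume "q \<in> (\<lambda>p. make_room n i \<circ> p) ` {p. p permutes {1..n}}"
    then show "q \<in> {p. p permutes {1..Suc n} \<and> p (Suc n) = i}"
      using append_letter_permutes[OF assms] append_letter_last by auto
  qed
  ultimately show ?thesis by (simp add: bij_betw_def)
qed

section \<open>Generating functions refined by the last letter\<close>

lemma sum_permutes_by_last:
  fixes g :: "(nat \<Rightarrow> nat) \<Rightarrow> 'a::comm_monoid_add"
  assumes "n \<ge> 1"
  shows "(\<Sum>p | p permutes {1..n}. g p) = (\<Sum>j=1..n. \<Sum>p | p permutes {1..n} \<and> p n = j. g p)"
proof -
  have "(\<Sum>j\<in>{1..n}. sum g {p \<in> {p. p permutes {1..n}}. p n = j}) = sum g {p. p permutes {1..n}}"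
  proof (rule sum.group)
    show "(\<lambda>p. p n) ` {p. p permutes {1..n}} \<subseteq> {1..n}"
      using assms permutes_letter_in_range[of _ n n] by auto
  qed (auto simp: finite_permutations)
  then show ?thesis by simp
qed

text \<open>The statistic \<open>T\<close> is left abstract so that one induction serves both
  statistics. Here \<open>e n i j\<close> is the growth of \<open>T\<close> when \<open>i\<close> is
  appended after the last letter \<open>j\<close>. Only its sum in \<open>kernel\<close> enters the
  result, which is therefore the same for all such \<open>T\<close>.\<close>

lemma last_letter_genfun:
  fixes T :: "nat \<Rightarrow> (nat \<Rightarrow> nat) \<Rightarrow> nat" and x :: "'a::comm_semiring_1"
  assumes base: "T 1 id = 0"
    and step: "\<And>n i p. n \<ge> 1 \<Longrightarrow> i \<in> {1..Suc n} \<Longrightarrow> p permutes {1..n} \<Longrightarrow>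
                 T (Suc n) (make_room n i \<circ> p) = T n p + e n i (p n)"
    and kernel: "\<And>n i. n \<ge> 1 \<Longrightarrow> i \<in> {1..Suc n} \<Longrightarrow>
                 (\<Sum>j=1..n. x ^ (e n i j + (n - j))) = x ^ (Suc n - i) * (\<Sum>m<n. x ^ m)"
    and n: "n \<ge> 1" and j: "j \<in> {1..n}"
  shows "(\<Sum>p | p permutes {1..n} \<and> p n = j. x ^ T n p) = x ^ (n - j) * (\<Prod>m=1..<n. \<Sum>l<m. x ^ l)"
  using n j
proof (induction n arbitrary: j rule: nat_induct_at_least)
  case base
  then have "{p. p permutes {1..1::nat} \<and> p 1 = j} = {id}" by auto
  then show ?case using base \<open>T 1 id = 0\<close> by (simp add: id_def)
next
  case (Suc n i)
  let ?K = "\<Prod>m=1..<n. \<Sum>l<m. x ^ l"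
  have "(\<Sum>p | p permutes {1..Suc n} \<and> p (Suc n) = i. x ^ T (Suc n) p)
      = (\<Sum>p | p permutes {1..n}. x ^ T (Suc n) (make_room n i \<circ> p))"
    by (rule sum.reindex_bij_betw[OF bij_betw_append_letter_fixed[OF Suc.prems], symmetric])
  also have "\<dots> = (\<Sum>p | p permutes {1..n}. x ^ (T n p + e n i (p n)))"
    by (intro sum.cong refl) (use step[OF Suc.hyps Suc.prems] in auto)
  also have "\<dots> = (\<Sum>j=1..n. \<Sum>p | p permutes {1..n} \<and> p n = j. x ^ (T n p + e n i (p n)))"
    by (rule sum_permutes_by_last[OF Suc.hyps])
  \<comment> \<open>Within a group the last letter is \<open>j\<close>, so the growth is constant
    and factors out.\<close>
  also have "\<dots> = (\<Sum>j=1..n. x ^ e n i j * (\<Sum>p | p permutes {1..n} \<and> p n = j. x ^ T n p))"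
    by (intro sum.cong refl) (auto simp: power_add sum_distrib_left mult.commute intro!: sum.cong)
  also have "\<dots> = (\<Sum>j=1..n. x ^ (e n i j + (n - j)) * ?K)"
    by (intro sum.cong refl) (simp only: Suc.IH power_add mult.assoc)
  also have "\<dots> = x ^ (Suc n - i) * (\<Sum>m<n. x ^ m) * ?K"
    by (simp only: sum_distrib_right[symmetric] kernel[OF Suc.hyps Suc.prems])
  also have "\<dots> = x ^ (Suc n - i) * (\<Prod>m=1..<Suc n. \<Sum>l<m. x ^ l)"
    using Suc.hyps by (simp add: mult_ac)
  finally show ?case .
qed

section \<open>Growth of the statistics under appending\<close>

lemma inv_count_Suc:
  "inv_count (Suc n) q = inv_count n q + card {m. 1 \<le> m \<and> m \<le> n \<and> q (Suc n) < q m}"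
proof -
  let ?A = "{(i, j). 1 \<le> i \<and> i < j \<and> j \<le> n \<and> q i > q j}"
  let ?B = "{m. 1 \<le> m \<and> m \<le> n \<and> q (Suc n) < q m}"
  have "{(i, j). 1 \<le> i \<and> i < j \<and> j \<le> Suc n \<and> q i > q j} = ?A \<union> (\<lambda>m. (m, Suc n)) ` ?B"
    by (auto simp: le_Suc_eq)
  moreover have "finite ?A" by (rule finite_subset[of _ "{..n} \<times> {..n}"]) auto
  moreover have "finite ?B" by (rule finite_subset[of _ "{..n}"]) auto
  moreover have "?A \<inter> (\<lambda>m. (m, Suc n)) ` ?B = {}" by auto
  ultimately show ?thesis
    unfolding inv_count_def by (simp add: card_Un_disjoint card_image inj_on_def)
qed

text \<open>The new occurrences are those whose adjacent pair occupies positions \<open>n\<close>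
  and \<open>Suc n\<close>. The relation \<open>R\<close> covers both \<open>b-ca\<close> and
  \<open>c-ab\<close>.\<close>

lemma card_vincular_Suc:
  fixes R :: "'a \<Rightarrow> 'a \<Rightarrow> 'a \<Rightarrow> bool"
  assumes "n \<ge> 1"
  shows "card {(i, j). 1 \<le> i \<and> i < j \<and> j < Suc n \<and> R (q i) (q j) (q (j + 1))}
    = card {(i, j). 1 \<le> i \<and> i < j \<and> j < n \<and> R (q i) (q j) (q (j + 1))}
      + card {m. 1 \<le> m \<and> m < n \<and> R (q m) (q n) (q (Suc n))}"
proof -
  let ?A = "{(i, j). 1 \<le> i \<and> i < j \<and> j < n \<and> R (q i) (q j) (q (j + 1))}"
  let ?B = "{m. 1 \<le> m \<and> m < n \<and> R (q m) (q n) (q (Suc n))}"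
  have "{(i, j). 1 \<le> i \<and> i < j \<and> j < Suc n \<and> R (q i) (q j) (q (j + 1))}
      = ?A \<union> (\<lambda>m. (m, n)) ` ?B"
    by (auto simp: less_Suc_eq)
  moreover have "finite ?A" by (rule finite_subset[of _ "{..n} \<times> {..n}"]) auto
  moreover have "finite ?B" by (rule finite_subset[of _ "{..n}"]) auto
  moreover have "?A \<inter> (\<lambda>m. (m, n)) ` ?B = {}" by auto
  ultimately show ?thesis by (simp add: card_Un_disjoint card_image inj_on_def)
qed

lemma pat_ba_Suc:
  assumes "n \<ge> 1"
  shows "pat_ba (Suc n) q = pat_ba n q + (if q (Suc n) < q n then 1 else 0)"
proof -
  have "{i. 1 \<le> i \<and> i < Suc n \<and> q i > q (i + 1)}
      = {i. 1 \<le> i \<and> i < n \<and> q i > q (i + 1)} \<union> (if q (Suc n) < q n then {n} else {})"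
    using assms by (auto simp: less_Suc_eq)
  moreover have "finite {i. 1 \<le> i \<and> i < n \<and> q i > q (i + 1)}"
    by (rule finite_subset[of _ "{..n}"]) auto
  ultimately show ?thesis unfolding pat_ba_def by auto
qed

text \<open>All four counts depend only on the relative order of the first \<open>n\<close> letters,
  which raising the letters from \<open>i\<close> on preserves.\<close>

lemma pattern_counts_make_room:
  assumes "p permutes {1..n}"
  shows "inv_count n (make_room n i \<circ> p) = inv_count n p"
    and "pat_b_ca n (make_room n i \<circ> p) = pat_b_ca n p"
    and "pat_c_ab n (make_room n i \<circ> p) = pat_c_ab n p"
    and "pat_ba n (make_room n i \<circ> p) = pat_ba n p"
proof -
  have less: "make_room n i (p a) < make_room n i (p b) \<longleftrightarrow> p a < p b"
    if "a \<in> {1..n}" "b \<in> {1..n}" for a b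
    using permutes_letter_in_range[OF assms] that by (intro make_room_less_iff) auto
  show "inv_count n (make_room n i \<circ> p) = inv_count n p"
    unfolding inv_count_def by (rule arg_cong[where f = card]) (auto simp: less)
  show "pat_b_ca n (make_room n i \<circ> p) = pat_b_ca n p"
    unfolding pat_b_ca_def by (rule arg_cong[where f = card]) (auto simp: less)
  show "pat_c_ab n (make_room n i \<circ> p) = pat_c_ab n p"
    unfolding pat_c_ab_def by (rule arg_cong[where f = card]) (auto simp: less)
  show "pat_ba n (make_room n i \<circ> p) = pat_ba n p"
    unfolding pat_ba_def by (rule arg_cong[where f = card]) (auto simp: less)
qed

text \<open>Each letter occupies exactly one position. This turns the counts of new occurrences into
  sizes of intervals of letters.\<close>

lemma card_positions_of_letters:
  fixes q :: "nat \<Rightarrow> nat"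
  assumes "q permutes {1..N}" "V \<subseteq> {1..N}"
  shows "card {m. m \<in> {1..N} \<and> q m \<in> V} = card V"
proof -
  have "q ` {m. m \<in> {1..N} \<and> q m \<in> V} = q ` {1..N} \<inter> V" by auto
  also have "\<dots> = V" using assms(2) by (simp only: permutes_image[OF assms(1)] Int_absorb1)
  finally show ?thesis
    using card_image[OF permutes_inj_on[OF assms(1)]] by metis
qed

lemma inv_count_append_letter:
  assumes "i \<in> {1..Suc n}" "p permutes {1..n}"
  shows "inv_count (Suc n) (make_room n i \<circ> p) = inv_count n p + (Suc n - i)"
proof -
  define q where "q = make_room n i \<circ> p"
  have q: "q permutes {1..Suc n}" "q (Suc n) = i"
    using append_letter_permutes[OF assms] append_letter_last[OF assms(2)] by (auto simp: q_def)
  have "{m. 1 \<le> m \<and> m \<le> n \<and> q (Suc n) < q m} = {m. m \<in> {1..Suc n} \<and> q m \<in> {i<..Suc n}}"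
    using permutes_letter_in_range[OF q(1)] q(2) by (auto simp: le_Suc_eq)
  then have "card {m. 1 \<le> m \<and> m \<le> n \<and> q (Suc n) < q m} = Suc n - i"
    using card_positions_of_letters[OF q(1), of "{i<..Suc n}"] by fastforce
  then show ?thesis
    using inv_count_Suc[of n q] pattern_counts_make_room(1)[OF assms(2)] by (simp add: q_def)
qed

text \<open>If \<open>p n < i\<close>, the new step is an ascent and every letter above
  \<open>i\<close> gives one \<open>c-ab\<close>. Otherwise it is a descent from
  \<open>p n + 1\<close> to \<open>i\<close>: the \<open>p n - i\<close> letters strictly between
  give one \<open>b-ca\<close> each, counted twice, and \<open>ba\<close> gains 1.\<close>

lemma pattern_sum_append_letter:
  assumes "n \<ge> 1" "i \<in> {1..Suc n}" "p permutes {1..n}"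
  defines "S \<equiv> \<lambda>n p. 2 * pat_b_ca n p + pat_c_ab n p + pat_ba n p"
  shows "S (Suc n) (make_room n i \<circ> p)
       = S n p + (if p n < i then Suc n - i else 2 * (p n - i) + 1)"
proof -
  define q where "q = make_room n i \<circ> p"
  have q: "q permutes {1..Suc n}" "q (Suc n) = i"
    using append_letter_permutes[OF assms(2,3)] append_letter_last[OF assms(3)]
    by (auto simp: q_def)
  have pn: "p n \<in> {1..n}" using permutes_letter_in_range[OF assms(3)] assms(1) by auto
  have qn: "q n = (if p n < i then p n else Suc (p n))"
    using pn by (auto simp: q_def make_room_def)
  have q_range: "q m \<in> {1..Suc n}" if "m \<in> {1..Suc n}" for m
    using permutes_letter_in_range[OF q(1) that] .
  \<comment> \<open>A letter in either interval used below differs from \<open>q n\<close> and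
    \<open>q (Suc n)\<close>, so its position is automatically less than \<open>n\<close>.\<close>
  have before: "m < n" if "m \<le> Suc n" "q m \<noteq> q n" "q m \<noteq> q (Suc n)" for m
    using that by (cases "m = n"; cases "m = Suc n") auto
  have "{m. 1 \<le> m \<and> m < n \<and> q (Suc n) < q m \<and> q m < q n}
      = {m. m \<in> {1..Suc n} \<and> q m \<in> {i<..<q n}}"
    using q(2) before by auto
  moreover have "{i<..<q n} \<subseteq> {1..Suc n}" using q_range[of n] assms(1) by auto
  \<comment> \<open>For an ascent the interval is empty and the truncated difference is 0, so no
    case split is needed.\<close>
  ultimately have b_ca: "card {m. 1 \<le> m \<and> m < n \<and> q (Suc n) < q m \<and> q m < q n} = q n - Suc i"
    using card_positions_of_letters[OF q(1), of "{i<..<q n}"] by simp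
  have "{m. 1 \<le> m \<and> m < n \<and> q n < q (Suc n) \<and> q (Suc n) < q m}
      = (if q n < i then {m. m \<in> {1..Suc n} \<and> q m \<in> {i<..Suc n}} else {})"
    using q(2) q_range before by auto
  then have c_ab: "card {m. 1 \<le> m \<and> m < n \<and> q n < q (Suc n) \<and> q (Suc n) < q m}
      = (if q n < i then Suc n - i else 0)"
    using card_positions_of_letters[OF q(1), of "{i<..Suc n}"] by fastforce
  have "pat_b_ca (Suc n) q = pat_b_ca n q + (q n - Suc i)"
    unfolding pat_b_ca_def b_ca[symmetric]
    by (rule card_vincular_Suc[OF assms(1), where R = "\<lambda>a b c. c < a \<and> a < b"])
  moreover have "pat_c_ab (Suc n) q = pat_c_ab n q + (if q n < i then Suc n - i else 0)"
    unfolding pat_c_ab_def c_ab[symmetric]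
    by (rule card_vincular_Suc[OF assms(1), where R = "\<lambda>a b c. b < c \<and> c < a"])
  moreover note pat_ba_Suc[OF assms(1), of q]
  ultimately show ?thesis
    using pattern_counts_make_room(2-4)[OF assms(3), of i] qn q(2)
    by (auto simp: S_def q_def[symmetric])
qed

section \<open>Summing over the former last letter\<close>

lemma inv_count_kernel:
  fixes x :: "'a::comm_semiring_1"
  shows "(\<Sum>j=1..n. x ^ ((Suc n - i) + (n - j))) = x ^ (Suc n - i) * (\<Sum>m<n. x ^ m)"
proof -
  have "(\<Sum>j=1..n. x ^ (n - j)) = (\<Sum>m<n. x ^ m)"
    by (rule sum.reindex_bij_witness[of _ "\<lambda>m. n - m" "\<lambda>j. n - j"]) auto
  then show ?thesis by (simp only: power_add sum_distrib_left[symmetric])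
qed

text \<open>After \<open>x ^ (Suc n - i)\<close> is split off, the letters \<open>j \<ge> i\<close>
  give the exponents \<open>0, ..., n - i\<close>, and the letters \<open>j < i\<close> give
  \<open>n + 1 - i, ..., n - 1\<close>.\<close>

lemma pattern_sum_kernel:
  fixes x :: "'a::comm_semiring_1"
  assumes "i \<in> {1..Suc n}"
  shows "(\<Sum>j=1..n. x ^ ((if j < i then Suc n - i else 2 * (j - i) + 1) + (n - j)))
       = x ^ (Suc n - i) * (\<Sum>m<n. x ^ m)"
proof -
  have "(if j < i then Suc n - i else 2 * (j - i) + 1) + (n - j)
      = (Suc n - i) + (if j < i then n - j else j - i)" if "j \<in> {1..n}" for j
    using that by auto
  then have "(\<Sum>j=1..n. x ^ ((if j < i then Suc n - i else 2 * (j - i) + 1) + (n - j)))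
      = (\<Sum>j=1..n. x ^ (Suc n - i) * x ^ (if j < i then n - j else j - i))"
    by (intro sum.cong refl) (simp only: power_add)
  moreover have "(\<Sum>j=1..n. x ^ (if j < i then n - j else j - i)) = (\<Sum>m<n. x ^ m)"
    \<comment> \<open>The threshold \<open>Suc n - i\<close> separates the two ranges of exponents:
      below it \<open>m\<close> comes from \<open>j = m + i\<close>, from it on \<open>m\<close>
      comes from \<open>j = n - m\<close>.\<close>
    by (rule sum.reindex_bij_witness[of _ "\<lambda>m. if m < Suc n - i then m + i else n - m"
          "\<lambda>j. if j < i then n - j else j - i"])
      (use assms in \<open>auto split: if_splits\<close>)
  ultimately show ?thesis by (simp only: sum_distrib_left[symmetric])
qed

section \<open>From generating functions to equidistribution\<close>

lemma coeff_genfun: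
  assumes "finite A"
  shows "coeff (\<Sum>a\<in>A. monom (1::nat) 1 ^ f a) k = card {a \<in> A. f a = k}"
proof -
  have "coeff (\<Sum>a\<in>A. monom (1::nat) 1 ^ f a) k = (\<Sum>a\<in>A. if f a = k then 1 else 0)"
    by (simp add: coeff_sum monom_power del: One_nat_def)
  also have "\<dots> = card {a \<in> A. f a = k}"
    using assms by (simp add: sum.If_cases Int_def)
  finally show ?thesis .
qed

theorem theorem5:
  fixes n :: nat and k :: int
  assumes "n \<ge> 1"
  shows "card {p. p permutes {1..n} \<and>
              int (2 * pat_b_ca n p + pat_c_ab n p + pat_ba n p) = k}
       = card {p. p permutes {1..n} \<and> int (inv_count n p) = k}"
proof (cases "k \<ge> 0")
  case True
  \<comment> \<open>With the polynomial variable for \<open>x\<close>, coefficients of the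
    generating function count permutations by the value of the statistic.\<close>
  let ?x = "monom (1::nat) 1"
  let ?S = "\<lambda>n p. 2 * pat_b_ca n p + pat_c_ab n p + pat_ba n p"
  have S0: "?S 1 id = 0" and I0: "inv_count 1 id = 0"
    by (auto simp: pat_b_ca_def pat_c_ab_def pat_ba_def inv_count_def card_eq_0_iff)
  have S: "(\<Sum>p | p permutes {1..n} \<and> p n = j. ?x ^ ?S n p)
      = ?x ^ (n - j) * (\<Prod>m=1..<n. \<Sum>l<m. ?x ^ l)" if "j \<in> {1..n}" for j
    by (rule last_letter_genfun[where T = ?S, OF S0 pattern_sum_append_letter pattern_sum_kernel
          assms that])
  have I: "(\<Sum>p | p permutes {1..n} \<and> p n = j. ?x ^ inv_count n p)
      = ?x ^ (n - j) * (\<Prod>m=1..<n. \<Sum>l<m. ?x ^ l)" if "j \<in> {1..n}" for j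
    \<comment> \<open>For inversions the growth does not depend on the former last letter
      \<open>j\<close>.\<close>
    by (rule last_letter_genfun[where T = inv_count and e = "\<lambda>n i j. Suc n - i",
          OF I0 inv_count_append_letter inv_count_kernel assms that])
  \<comment> \<open>The two sums agree already on each class of permutations with a given last
    letter.\<close>
  have "(\<Sum>p | p permutes {1..n}. ?x ^ ?S n p) = (\<Sum>p | p permutes {1..n}. ?x ^ inv_count n p)"
    unfolding sum_permutes_by_last[OF assms] by (rule sum.cong[OF refl]) (simp only: S I)
  then have "card {p \<in> {p. p permutes {1..n}}. ?S n p = nat k}
      = card {p \<in> {p. p permutes {1..n}}. inv_count n p = nat k}"
    by (simp only: coeff_genfun[OF finite_permutations[OF finite_atLeastAtMost], symmetric])
  moreover have "int m = k \<longleftrightarrow> m = nat k" for m using True by auto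
  ultimately show ?thesis by (simp only: mem_Collect_eq)
next
  case False
  \<comment> \<open>Both statistics are natural numbers, so for negative \<open>k\<close> both sets
    are empty.\<close>
  then have "int m \<noteq> k" for m by auto
  then show ?thesis by (simp only: simp_thms)
qed

end
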